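(* Let $T:[0,1]\to[0,1]$ be a nonsingular Borel map and let $\rho\in BV[-1,1]$ be a symmetric probability density on $[-1,1]$. Then the random dynamical system with additive noise $x_{n+1}=T(x_n)\hat+\Omega_n$, with $\Omega_n$ i.i.d. distributed according to $\rho$, has an absolutely continuous stationary probability measure with density $h\in BV[0,1]$, and $$\|h\|_{BV}\le3\|\rho\|_{BV}.$$
   Context: $m$ is Lebesgue measure; $T$ is nonsingular if $m(T^{-1}(A))=0\iff m(A)=0$. Symmetric: $\rho(x)=\rho(-x)$. Reflecting boundary sum: $a\hat+b:=\pi(a+b)$, where $\pi:\mathbb R\to[0,1]$, $\pi(x)=\min_{i\in\mathbb Z}|x-2i|$. The transfer operator of the system is $L\nu=\pi_*[\mu_\rho*L_T\nu]$, where $L_T\nu(A)=\nu(T^{-1}(A))$ is the pushforward by $T$, $\mu_\rho=\rho\,m$, $*$ is convolution of measures on $\mathbb R$ and $\pi_*$ is the pushforward by $\pi$. A probability measure $\eta$ is stationary if $L\eta=\eta$. For a function $\phi$ on an interval, $Var(\phi)=\sup\sum_i|\phi(x_i)-\phi(x_{i+1})|$ over finite increasing sequences of points (for an a.e. class, the infimum over representatives), $\|\phi\|_{BV}=Var(\phi)+\|\phi\|_1$, and $BV$ is the set of functions with $Var(\phi)<\infty$. *)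

theory Defs
  imports "HOL-Probability.Probability"
begin

text \<open>Functions on an interval \<open>S\<close> are rendered as functions on the reals whose values outside
  \<open>S\<close> are never consulted; a.e. statements on \<open>S\<close> refer to the measure space below.\<close>

abbreviation leb_on :: "real set \<Rightarrow> real measure" where
  "leb_on S \<equiv> restrict_space lborel S"

definition variation_on :: "real set \<Rightarrow> (real \<Rightarrow> real) \<Rightarrow> ennreal" where
  "variation_on S \<phi> =
    (SUP (n, x) \<in> {(n, x). strict_mono_on {..n} x \<and> x ` {..n} \<subseteq> S}.
       \<Sum>i<(n::nat). ennreal \<bar>\<phi> (x i) - \<phi> (x (Suc i))\<bar>)"

text \<open>Variation of the a.e. class of \<open>\<phi>\<close> on \<open>S\<close>.\<close>

definition ess_variation_on :: "real set \<Rightarrow> (real \<Rightarrow> real) \<Rightarrow> ennreal" where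
  "ess_variation_on S \<phi> = (INF \<psi> \<in> {\<psi>. AE x in leb_on S. \<psi> x = \<phi> x}. variation_on S \<psi>)"

definition BV_on :: "real set \<Rightarrow> (real \<Rightarrow> real) set" where
  "BV_on S = {\<phi>. ess_variation_on S \<phi> < \<infinity>}"

definition BV_norm_on :: "real set \<Rightarrow> (real \<Rightarrow> real) \<Rightarrow> ennreal" where
  "BV_norm_on S \<phi> = ess_variation_on S \<phi> + (\<integral>\<^sup>+ x. ennreal \<bar>\<phi> x\<bar> \<partial>leb_on S)"

definition prob_density_on :: "real set \<Rightarrow> (real \<Rightarrow> real) \<Rightarrow> bool" where
  "prob_density_on S f \<longleftrightarrow>
    f \<in> borel_measurable (leb_on S) \<and> (AE x in leb_on S. 0 \<le> f x) \<and>
    (\<integral>\<^sup>+ x. ennreal (f x) \<partial>leb_on S) = 1"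

definition nonsingular :: "'a measure \<Rightarrow> ('a \<Rightarrow> 'a) \<Rightarrow> bool" where
  "nonsingular M T \<longleftrightarrow>
    (\<forall>A\<in>sets M. emeasure M (T -` A \<inter> space M) = 0 \<longleftrightarrow> emeasure M A = 0)"

text \<open>Folding of the line onto the unit interval; the infimum is attained
  (lemma \<open>fold_unit_attained\<close>).\<close>

definition fold_unit :: "real \<Rightarrow> real" where
  "fold_unit x = (INF i::int. \<bar>x - 2 * of_int i\<bar>)"

text \<open>The measure \<open>\<rho> m\<close> on the line, for a density \<open>\<rho>\<close> on \<open>[-1,1]\<close> (extended by zero).\<close>

definition noise_measure :: "(real \<Rightarrow> real) \<Rightarrow> real measure" where
  "noise_measure \<rho> = density lborel (\<lambda>x. ennreal (\<rho> x) * indicator {-1..1} x)"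

text \<open>The transfer operator acts on measures on the Borel space \<open>[0,1]\<close>; the pushforward by \<open>T\<close>
  is taken as a measure on the line, so that the convolution makes sense. Thus
  \<open>transfer_op T \<rho> \<nu>\<close> is the law of \<open>fold_unit (T x + \<omega>)\<close> for independent
  \<open>x\<close> and \<open>\<omega>\<close> with laws \<open>\<nu>\<close> and \<open>\<rho> m\<close>.\<close>

definition transfer_op :: "(real \<Rightarrow> real) \<Rightarrow> (real \<Rightarrow> real) \<Rightarrow> real measure \<Rightarrow> real measure" where
  "transfer_op T \<rho> \<nu> =
    distr (noise_measure \<rho> \<star> distr \<nu> borel T) (restrict_space borel {0..1}) fold_unit"

definition stationary :: "(real \<Rightarrow> real) \<Rightarrow> (real \<Rightarrow> real) \<Rightarrow> real measure \<Rightarrow> bool" where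
  "stationary T \<rho> \<eta> \<longleftrightarrow>
    prob_space \<eta> \<and> sets \<eta> = sets (restrict_space borel {0..1}) \<and> transfer_op T \<rho> \<eta> = \<eta>"

lemma fold_unit_attained:
  "\<exists>i::int. fold_unit x = \<bar>x - 2 * of_int i\<bar> \<and> (\<forall>j::int. \<bar>x - 2 * of_int i\<bar> \<le> \<bar>x - 2 * of_int j\<bar>)"
proof -
  define i where "i = round (x / 2)"
  have le: "\<bar>x - 2 * of_int i\<bar> \<le> \<bar>x - 2 * of_int j\<bar>" for j :: int
    using round_diff_minimal[of "x / 2" j] unfolding i_def by linarith
  have "fold_unit x = \<bar>x - 2 * of_int i\<bar>"
    unfolding fold_unit_def by (rule cInf_eq_minimum) (auto intro: le)
  with le show ?thesis by blast
qed

lemma fold_unit_in_unit: "fold_unit x \<in> {0..1}"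
proof -
  obtain i :: int where i: "fold_unit x = \<bar>x - 2 * of_int i\<bar>"
    "\<And>j::int. \<bar>x - 2 * of_int i\<bar> \<le> \<bar>x - 2 * of_int j\<bar>"
    using fold_unit_attained[of x] by blast
  have "\<bar>x - 2 * of_int (round (x / 2))\<bar> \<le> 1"
    using of_int_round_abs_le[of "x / 2"] by linarith
  with i(1) i(2)[of "round (x / 2)"] show ?thesis by simp
qed

lemma fold_unit_measurable: "fold_unit \<in> borel \<rightarrow>\<^sub>M restrict_space borel {0..1}"
proof -
  have eq: "fold_unit x = \<bar>x - 2 * of_int (round (x / 2))\<bar>" for x
    unfolding fold_unit_def
  proof (rule cInf_eq_minimum)
    fix y assume "y \<in> range (\<lambda>i::int. \<bar>x - 2 * of_int i\<bar>)"
    then obtain j :: int where "y = \<bar>x - 2 * of_int j\<bar>" by blast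
    then show "\<bar>x - 2 * of_int (round (x / 2))\<bar> \<le> y"
      using round_diff_minimal[of "x / 2" j] by linarith
  qed auto
  have "(\<lambda>x. \<bar>x - 2 * of_int (round (x / 2))\<bar>) \<in> borel_measurable (borel :: real measure)"
    unfolding round_def by measurable
  then have "fold_unit \<in> borel_measurable borel"
    by (simp add: eq[abs_def])
  then show ?thesis
    by (rule measurable_restrict_space2[rotated]) (use fold_unit_in_unit in auto)
qed

end

theory Submission
  imports Defs
begin

text \<open>Write \<open>g\<close> for the noise density extended by zero to the line. Started from \<open>x\<close>, one step of
  the system has a density at \<open>y\<close> in \<open>[0,1]\<close>, namely \<open>kernel t y\<close> with \<open>t = T x\<close>, a sum of three
  values of \<open>g\<close>, one for each of the points \<open>- y\<close>, \<open>y\<close>, \<open>2 - y\<close> that fold to \<open>y\<close>. As \<open>y\<close> runs through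
  \<open>[0,1]\<close>, these points sweep adjacent intervals, so a bound \<open>C\<close> on the variation of \<open>g\<close> over the line
  bounds the variation of the kernel too,
  uniformly in \<open>t\<close> (\<open>kernel_control\<close>, \<open>kernel_control_range\<close>). A stationary law \<open>\<eta>\<close> is an average of
  these kernels: its density \<open>h\<close> is the mean of \<open>kernel (T x)\<close> over \<open>x\<close> distributed by \<open>\<eta>\<close>
  (\<open>folded_law_eq_density\<close>), and its variation is at most \<open>C\<close> as well
  (\<open>variation_on_averaged_kernel_le\<close>). If \<open>v\<close> is the variation of \<open>g\<close> on \<open>[-1,1]\<close>, then the jumps at
  the end points are bounded by \<open>v + 1\<close>, so \<open>C \<le> 2 * v + 1\<close> (\<open>controlled_zero_extension\<close>). With \<open>h\<close> of
  integral 1 this yields \<open>2 * v + 2\<close> for the norm of \<open>h\<close>, while three times the norm of the noise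
  density is \<open>3 * v + 3\<close> for the best \<open>v\<close>.

  A stationary law exists because the noise regularizes: the mean of a bounded Borel function after
  the noise depends continuously on the point before it (\<open>isCont_smooth\<close>). Weak compactness of the
  images under \<open>T\<close> of Cesaro averages therefore gives convergence of the averages against all
  bounded Borel functions, and the limit is stationary although \<open>T\<close> may be discontinuous
  (\<open>exists_fixed_law\<close>).\<close>

section \<open>Variation and monotone controls\<close>

lemma variation_on_upper:
  assumes "strict_mono_on {..n} x" "x ` {..n} \<subseteq> S"
  shows "(\<Sum>i<n. ennreal \<bar>\<phi> (x i) - \<phi> (x (Suc i))\<bar>) \<le> variation_on S \<phi>"
  unfolding variation_on_def using assms by (intro SUP_upper2[of "(n, x)"]) auto

lemma variation_on_least:
  assumes "\<And>n x. strict_mono_on {..n} x \<Longrightarrow> x ` {..n} \<subseteq> S \<Longrightarrow>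
    (\<Sum>i<n. ennreal \<bar>\<phi> (x i) - \<phi> (x (Suc i))\<bar>) \<le> B"
  shows "variation_on S \<phi> \<le> B"
  unfolding variation_on_def using assms by (intro SUP_least) auto

lemma variation_on_mono: "S \<subseteq> S' \<Longrightarrow> variation_on S \<phi> \<le> variation_on S' \<phi>"
  by (rule variation_on_least, rule variation_on_upper) auto

lemma variation_on_abs_le: "variation_on S (\<lambda>x. \<bar>\<phi> x\<bar>) \<le> variation_on S \<phi>"
proof (rule variation_on_least)
  fix n :: nat and x assume x: "strict_mono_on {..n} x" "x ` {..n} \<subseteq> S"
  have "(\<Sum>i<n. ennreal \<bar>\<bar>\<phi> (x i)\<bar> - \<bar>\<phi> (x (Suc i))\<bar>\<bar>) \<le> (\<Sum>i<n. ennreal \<bar>\<phi> (x i) - \<phi> (x (Suc i))\<bar>)"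
    by (intro sum_mono ennreal_leI) (rule abs_triangle_ineq3)
  also have "\<dots> \<le> variation_on S \<phi>" by (rule variation_on_upper[OF x])
  finally show "(\<Sum>i<n. ennreal \<bar>\<bar>\<phi> (x i)\<bar> - \<bar>\<phi> (x (Suc i))\<bar>\<bar>) \<le> variation_on S \<phi>" .
qed

text \<open>A function whose increments are dominated by those of a function \<open>H\<close> has its variation sums
  dominated by telescoping sums. This form of the bound survives averaging over a parameter, which
  is why the estimates below carry a control function along instead of a variation.\<close>

lemma variation_on_le_of_control:
  fixes \<phi> H :: "real \<Rightarrow> real"
  assumes control: "\<And>x y. x \<in> S \<Longrightarrow> y \<in> S \<Longrightarrow> x \<le> y \<Longrightarrow> \<bar>\<phi> x - \<phi> y\<bar> \<le> H y - H x"
    and range: "\<And>x y. x \<in> S \<Longrightarrow> y \<in> S \<Longrightarrow> x \<le> y \<Longrightarrow> H y - H x \<le> C"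
  shows "variation_on S \<phi> \<le> ennreal C"
proof (rule variation_on_least)
  fix n :: nat and x assume x: "strict_mono_on {..n} x" "x ` {..n} \<subseteq> S"
  have S: "x i \<in> S" if "i \<le> n" for i using x(2) that by auto
  have le: "x i \<le> x j" if "i \<le> j" "j \<le> n" for i j
    using strict_mono_onD[OF x(1), of i j] that by (cases "i = j") auto
  have "(\<Sum>i<n. \<bar>\<phi> (x i) - \<phi> (x (Suc i))\<bar>) \<le> (\<Sum>i<n. H (x (Suc i)) - H (x i))"
    by (intro sum_mono control S le) auto
  also have "\<dots> = H (x n) - H (x 0)" by (rule sum_lessThan_telescope)
  also have "\<dots> \<le> C" by (intro range S le) auto
  finally show "(\<Sum>i<n. ennreal \<bar>\<phi> (x i) - \<phi> (x (Suc i))\<bar>) \<le> ennreal C"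
    by (simp add: sum_ennreal ennreal_leI)
qed

lemma sum_append_point:
  fixes x :: "nat \<Rightarrow> real" and \<phi> :: "real \<Rightarrow> real"
  assumes x: "strict_mono_on {..n} x" "x ` {..n} \<subseteq> S" and b: "x n < b" "b \<in> S"
  shows "strict_mono_on {..Suc n} (x(Suc n := b))" "(x(Suc n := b)) ` {..Suc n} \<subseteq> S"
    and "(\<Sum>i<Suc n. ennreal \<bar>\<phi> ((x(Suc n := b)) i) - \<phi> ((x(Suc n := b)) (Suc i))\<bar>) =
      (\<Sum>i<n. ennreal \<bar>\<phi> (x i) - \<phi> (x (Suc i))\<bar>) + ennreal \<bar>\<phi> (x n) - \<phi> b\<bar>"
proof -
  have "x i < b" if "i \<le> n" for i
    using strict_mono_onD[OF x(1), of i n] that b by (cases "i = n") (auto intro: less_trans)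
  then show "strict_mono_on {..Suc n} (x(Suc n := b))"
    using x(1) by (auto simp: strict_mono_on_def)
  show "(x(Suc n := b)) ` {..Suc n} \<subseteq> S" using x(2) b by auto
qed auto

text \<open>Half of the additivity of the variation: points of a partition left of \<open>a\<close> can be continued
  by \<open>a\<close>, if it is not yet the last one, and then by \<open>b\<close>.\<close>

lemma variation_on_add_step_le:
  fixes \<phi> :: "real \<Rightarrow> real"
  assumes ab: "a \<in> S" "b \<in> S" "a < b"
  shows "variation_on (S \<inter> {..a}) \<phi> + ennreal \<bar>\<phi> a - \<phi> b\<bar> \<le> variation_on (S \<inter> {..b}) \<phi>"
proof -
  define c where "c = ennreal \<bar>\<phi> a - \<phi> b\<bar>"
  have step: "(\<Sum>i<n. ennreal \<bar>\<phi> (x i) - \<phi> (x (Suc i))\<bar>) + c \<le> variation_on (S \<inter> {..b}) \<phi>"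
    if x: "strict_mono_on {..n} x" "x ` {..n} \<subseteq> S \<inter> {..a}" for n x
  proof -
    have xb: "x ` {..n} \<subseteq> S \<inter> {..b}" using x(2) ab by auto
    have xa: "x n \<le> a" using x(2) by auto
    show ?thesis
    proof (cases "x n = a")
      case True
      note app = sum_append_point[OF x(1) xb, of b]
      show ?thesis
        using variation_on_upper[OF app(1,2), of \<phi>] app(3)[of \<phi>] True ab unfolding c_def by simp
    next
      case False
      let ?y = "x(Suc n := a)"
      have na: "x n < a" "a \<in> S \<inter> {..b}" using False xa ab by auto
      note app = sum_append_point[OF x(1) xb na]
      have nb: "?y (Suc n) < b" "b \<in> S \<inter> {..b}" using ab by auto
      note app' = sum_append_point[OF app(1,2) nb]
      have "(\<Sum>i<n. ennreal \<bar>\<phi> (x i) - \<phi> (x (Suc i))\<bar>) + c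
          \<le> (\<Sum>i<n. ennreal \<bar>\<phi> (x i) - \<phi> (x (Suc i))\<bar>) + ennreal \<bar>\<phi> (x n) - \<phi> a\<bar> + c"
        by (intro add_right_mono) simp
      also have "\<dots> \<le> variation_on (S \<inter> {..b}) \<phi>"
        using variation_on_upper[OF app'(1,2), of \<phi>] unfolding app'(3) app(3) c_def by simp
      finally show ?thesis .
    qed
  qed
  let ?I = "{(n::nat, x). strict_mono_on {..n} x \<and> x ` {..n} \<subseteq> S \<inter> {..a}}"
  have "(0::nat, \<lambda>_. a) \<in> ?I" using ab by (auto simp: strict_mono_on_def)
  then have "?I \<noteq> {}" by (metis empty_iff)
  then have "variation_on (S \<inter> {..a}) \<phi> + c =
      (SUP (n, x) \<in> ?I. (\<Sum>i<(n::nat). ennreal \<bar>\<phi> (x i) - \<phi> (x (Suc i))\<bar>) + c)"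
    unfolding variation_on_def
    by (subst ennreal_SUP_add_left[symmetric]) (auto simp: c_def split_beta)
  also have "\<dots> \<le> variation_on (S \<inter> {..b}) \<phi>"
    using step by (intro SUP_least) auto
  finally show ?thesis unfolding c_def .
qed

text \<open>Jordan's idea: the variation up to \<open>x\<close>, as a function of \<open>x\<close>, controls the increments.\<close>

lemma bounded_variation_control:
  fixes \<phi> :: "real \<Rightarrow> real"
  assumes fin: "variation_on S \<phi> = ennreal v" and v: "0 \<le> v"
  obtains V where "\<And>x y. x \<in> S \<Longrightarrow> y \<in> S \<Longrightarrow> x \<le> y \<Longrightarrow> \<bar>\<phi> x - \<phi> y\<bar> \<le> V y - V x"
    and "\<And>x. 0 \<le> V x" "\<And>x. V x \<le> v"
proof
  define V where "V x = enn2real (variation_on (S \<inter> {..x}) \<phi>)" for x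
  have le: "variation_on (S \<inter> {..x}) \<phi> \<le> ennreal v" for x
    using variation_on_mono[of "S \<inter> {..x}" S \<phi>] fin by simp
  have V: "variation_on (S \<inter> {..x}) \<phi> = ennreal (V x)" for x
    unfolding V_def by (intro ennreal_enn2real[symmetric] le_less_trans[OF le ennreal_less_top])
  show V0: "0 \<le> V x" for x unfolding V_def by simp
  show "V x \<le> v" for x using le[of x] v unfolding V by simp
  show "\<bar>\<phi> x - \<phi> y\<bar> \<le> V y - V x" if "x \<in> S" "y \<in> S" "x \<le> y" for x y
  proof (cases "x = y")
    case False
    then have "ennreal (V x) + ennreal \<bar>\<phi> x - \<phi> y\<bar> \<le> ennreal (V y)"
      using variation_on_add_step_le[of x S y \<phi>] that unfolding V by simp
    then have "V x + \<bar>\<phi> x - \<phi> y\<bar> \<le> V y"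
      using V0 by (simp flip: ennreal_plus)
    then show ?thesis by simp
  qed simp
qed

section \<open>Folding\<close>

lemma fold_unit_eq: "\<bar>x - 2 * of_int i\<bar> \<le> 1 \<Longrightarrow> fold_unit x = \<bar>x - 2 * of_int i\<bar>"
proof -
  assume *: "\<bar>x - 2 * of_int i\<bar> \<le> 1"
  have "\<bar>x - 2 * of_int i\<bar> \<le> \<bar>x - 2 * of_int j\<bar>" for j
  proof (cases "i = j")
    case False
    then have "1 \<le> \<bar>real_of_int i - of_int j\<bar>" by linarith
    with * show ?thesis by linarith
  qed simp
  then show ?thesis unfolding fold_unit_def by (intro cInf_eq_minimum) auto
qed

lemma fold_unit_cases:
  "x \<in> {-1..0} \<Longrightarrow> fold_unit x = - x" "x \<in> {0..1} \<Longrightarrow> fold_unit x = x"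
  "x \<in> {1..2} \<Longrightarrow> fold_unit x = 2 - x"
  using fold_unit_eq[of x 0] fold_unit_eq[of x 1] by auto

lemma borel_measurable_fold_unit [measurable]: "fold_unit \<in> borel_measurable borel"
  using fold_unit_measurable by (simp add: measurable_restrict_space2_iff)

text \<open>On \<open>[-1,2]\<close> the folding map is piecewise an isometry onto \<open>[0,1]\<close>, with the three
  branches \<open>y\<close>, \<open>-y\<close>, \<open>2 - y\<close> as inverses; the branches overlap only in the null set
  of their end points.\<close>

lemma nn_integral_fold_unit:
  fixes G f :: "real \<Rightarrow> ennreal"
  assumes [measurable]: "G \<in> borel_measurable borel" "f \<in> borel_measurable borel"
    and supp: "\<And>z. z \<notin> {-1..2} \<Longrightarrow> G z = 0"
  shows "(\<integral>\<^sup>+z. G z * f (fold_unit z) \<partial>lborel) =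
    (\<integral>\<^sup>+y. (G y + G (- y) + G (2 - y)) * f y * indicator {0..1} y \<partial>lborel)"
proof -
  let ?F = "\<lambda>z. G z * f (fold_unit z)"
  have AE: "AE z in lborel. z \<noteq> (0::real) \<and> z \<noteq> 1"
    by (intro AE_conjI AE_lborel_singleton)
  have "(\<integral>\<^sup>+z. ?F z \<partial>lborel) =
    (\<integral>\<^sup>+z. ?F z * indicator {0..1} z + ?F z * indicator {-1..0} z + ?F z * indicator {1..2} z \<partial>lborel)"
    by (rule nn_integral_cong_AE) (use AE supp in \<open>auto split: split_indicator\<close>)
  also have "\<dots> = (\<integral>\<^sup>+z. ?F z * indicator {0..1} z \<partial>lborel)
     + (\<integral>\<^sup>+z. ?F z * indicator {-1..0} z \<partial>lborel) + (\<integral>\<^sup>+z. ?F z * indicator {1..2} z \<partial>lborel)"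
    by (simp add: nn_integral_add)
  also have "(\<integral>\<^sup>+z. ?F z * indicator {0..1} z \<partial>lborel) = (\<integral>\<^sup>+y. G y * f y * indicator {0..1} y \<partial>lborel)"
    by (intro nn_integral_cong) (auto simp: fold_unit_cases split: split_indicator)
  also have "(\<integral>\<^sup>+z. ?F z * indicator {-1..0} z \<partial>lborel) = (\<integral>\<^sup>+y. G (- y) * f y * indicator {0..1} y \<partial>lborel)"
    by (subst nn_integral_real_affine[where c="-1" and t=0], measurable)
       (auto intro!: nn_integral_cong simp: fold_unit_cases split: split_indicator)
  also have "(\<integral>\<^sup>+z. ?F z * indicator {1..2} z \<partial>lborel) = (\<integral>\<^sup>+y. G (2 - y) * f y * indicator {0..1} y \<partial>lborel)"
    by (subst nn_integral_real_affine[where c="-1" and t=2], measurable)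
       (auto intro!: nn_integral_cong simp: fold_unit_cases split: split_indicator)
  also have "(\<integral>\<^sup>+y. G y * f y * indicator {0..1} y \<partial>lborel) + (\<integral>\<^sup>+y. G (- y) * f y * indicator {0..1} y \<partial>lborel)
     + (\<integral>\<^sup>+y. G (2 - y) * f y * indicator {0..1} y \<partial>lborel) =
     (\<integral>\<^sup>+y. (G y + G (- y) + G (2 - y)) * f y * indicator {0..1} y \<partial>lborel)"
    by (simp add: nn_integral_add[symmetric] distrib_right)
  finally show ?thesis .
qed

section \<open>Folded noise with a controlled density\<close>

abbreviation unit_borel :: "real measure" where
  "unit_borel \<equiv> restrict_space borel {0..1}"

text \<open>The noise density is extended by zero to the whole line. Its variation there is recorded by a
  nondecreasing \<open>W\<close> with values in \<open>[0,C]\<close>, so that \<open>C\<close> also accounts for the jumps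
  at \<open>-1\<close> and \<open>1\<close>.\<close>

locale controlled_density =
  fixes g W :: "real \<Rightarrow> real" and C :: real
  assumes control: "x \<le> y \<Longrightarrow> \<bar>g x - g y\<bar> \<le> W y - W x"
    and W_nonneg: "0 \<le> W x" and W_le: "W x \<le> C"
    and g_nonneg: "0 \<le> g x" and g_support: "x \<notin> {-1..1} \<Longrightarrow> g x = 0"
    and g_mass: "(\<integral>\<^sup>+x. ennreal (g x) \<partial>lborel) = 1"
begin

definition noise :: "real measure" where
  "noise = density lborel (\<lambda>x. ennreal (g x))"

definition folded_law :: "real measure \<Rightarrow> real measure" where
  "folded_law \<nu> = distr (noise \<star> \<nu>) unit_borel fold_unit"

text \<open>The dual of \<open>folded_law\<close> on test functions: \<open>smooth f t\<close> is the mean of \<open>f\<close> at the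
  folded value of \<open>t\<close> plus noise.\<close>

definition smooth :: "(real \<Rightarrow> real) \<Rightarrow> real \<Rightarrow> real" where
  "smooth f t = (\<integral>z. g (z - t) * f (fold_unit z) \<partial>lborel)"

text \<open>The transition density from \<open>t\<close> in \<open>[0,1]\<close> to \<open>y\<close>; the summands belong to the three
  branches on which \<open>[-1,2]\<close>, the range of \<open>t\<close> plus noise, folds onto \<open>[0,1]\<close>.\<close>

definition kernel :: "real \<Rightarrow> real \<Rightarrow> real" where
  "kernel t y = g (y - t) + g (- y - t) + g (2 - y - t)"

lemma W_mono: "mono W"
proof
  fix x y :: real assume "x \<le> y"
  then show "W x \<le> W y" using control[of x y] by linarith
qed

lemma W_minus_g_mono: "mono (\<lambda>x. W x - g x)"
proof
  fix x y :: real assume "x \<le> y"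
  then show "W x - g x \<le> W y - g y" using control[of x y] by linarith
qed

lemma borel_measurable_W [measurable]: "W \<in> borel_measurable borel"
  by (rule borel_measurable_mono[OF W_mono])

lemma borel_measurable_g [measurable]: "g \<in> borel_measurable borel"
proof -
  have "(\<lambda>x. W x - (W x - g x)) \<in> borel_measurable borel"
    by (intro borel_measurable_diff borel_measurable_W borel_measurable_mono[OF W_minus_g_mono])
  then show ?thesis by simp
qed

text \<open>A difference of two monotone functions is discontinuous only where one of them is.\<close>

lemma countable_discontinuities: "countable {x. \<not> isCont g x}"
proof -
  have "isCont g x" if "isCont W x" "isCont (\<lambda>x. W x - g x) x" for x
    using continuous_diff[OF that] by simp
  then have "{x. \<not> isCont g x} \<subseteq> {x. \<not> isCont W x} \<union> {x. \<not> isCont (\<lambda>x. W x - g x) x}"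
    by blast
  then show ?thesis
    by (rule countable_subset) (intro countable_Un mono_ctble_discont W_mono W_minus_g_mono)
qed

lemma g_le: "g x \<le> C"
proof (cases "x \<in> {-1..1}")
  case True
  then show ?thesis using control[of "-2" x] g_support[of "-2"] W_nonneg[of "-2"] W_le[of x] by auto
next
  case False
  then show ?thesis using g_support[of x] W_nonneg[of x] W_le[of x] by simp
qed

lemma C_nonneg: "0 \<le> C" using W_nonneg[of 0] W_le[of 0] by linarith

lemma sets_noise [simp, measurable_cong]: "sets noise = sets borel"
  by (simp add: noise_def)

lemma prob_space_noise: "prob_space noise"
  by (rule prob_spaceI) (simp add: noise_def emeasure_density g_mass)

lemma integrable_g_mult:
  fixes f :: "real \<Rightarrow> real"
  assumes [measurable]: "f \<in> borel_measurable borel" and b: "\<And>x. \<bar>f x\<bar> \<le> b"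
  shows "integrable lborel (\<lambda>z. g (z - t) * f z)"
proof (rule integrableI_bounded_set[where A="{t-1..t+1}" and B="C * b"])
  show "AE z in lborel. z \<in> {t-1..t+1} \<longrightarrow> norm (g (z - t) * f z) \<le> C * b"
    using b g_le g_nonneg C_nonneg by (auto simp: abs_mult intro!: mult_mono)
  show "AE z in lborel. z \<notin> {t-1..t+1} \<longrightarrow> g (z - t) * f z = 0"
    by (auto simp: g_support)
qed auto

lemma integral_noise_shift:
  fixes F :: "real \<Rightarrow> real"
  assumes [measurable]: "F \<in> borel_measurable borel"
  shows "(\<integral>x. F (x + t) \<partial>noise) = (\<integral>z. g (z - t) * F z \<partial>lborel)"
proof -
  have "(\<integral>x. F (x + t) \<partial>noise) = (\<integral>x. g x * F (x + t) \<partial>lborel)"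
    unfolding noise_def by (subst integral_density) (auto simp: g_nonneg)
  also have "\<dots> = (\<integral>z. g (z - t) * F z \<partial>lborel)"
    by (subst lborel_integral_real_affine[where c=1 and t=t and f="\<lambda>z. g (z - t) * F z"])
       (auto simp: add.commute)
  finally show ?thesis .
qed

lemma integral_density_one: "(\<integral>z. g (z - t) \<partial>lborel) = 1"
  using integral_noise_shift[of "\<lambda>_. 1" t] prob_space.prob_space[OF prob_space_noise] by simp

lemma abs_smooth_le:
  assumes [measurable]: "f \<in> borel_measurable unit_borel"
    and b: "\<And>x. x \<in> {0..1} \<Longrightarrow> \<bar>f x\<bar> \<le> b"
  shows "\<bar>smooth f t\<bar> \<le> b"
proof -
  have [measurable]: "(\<lambda>z. f (fold_unit z)) \<in> borel_measurable borel"
    by (rule measurable_compose[OF fold_unit_measurable assms(1)])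
  have b': "\<bar>f (fold_unit z)\<bar> \<le> b" for z by (intro b fold_unit_in_unit)
  have "\<bar>smooth f t\<bar> \<le> (\<integral>z. \<bar>g (z - t) * f (fold_unit z)\<bar> \<partial>lborel)"
    unfolding smooth_def by (rule integral_abs_bound)
  also have "\<dots> \<le> (\<integral>z. g (z - t) * b \<partial>lborel)"
    using integrable_g_mult[of "\<lambda>z. f (fold_unit z)" b t] integrable_g_mult[of "\<lambda>z. b" "\<bar>b\<bar>" t] b'
    by (intro integral_mono integrable_abs) (auto simp: abs_mult g_nonneg intro!: mult_left_mono)
  also have "\<dots> = b" by (simp add: integral_density_one)
  finally show ?thesis .
qed

text \<open>The shifted densities converge at every point that is not a translate of a discontinuity of
  \<open>g\<close>, hence almost everywhere, and the integrals converge by dominated convergence. The test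
  function itself may be as discontinuous as it likes: this is where the noise regularizes.\<close>

lemma isCont_smooth:
  assumes [measurable]: "f \<in> borel_measurable unit_borel"
    and b: "\<And>x. x \<in> {0..1} \<Longrightarrow> \<bar>f x\<bar> \<le> b"
  shows "isCont (smooth f) t"
  unfolding continuous_at_sequentially o_def
proof (intro allI impI)
  fix u :: "nat \<Rightarrow> real" assume u: "u \<longlonglongrightarrow> t"
  have [measurable]: "(\<lambda>z. f (fold_unit z)) \<in> borel_measurable borel"
    by (rule measurable_compose[OF fold_unit_measurable assms(1)])
  have b': "\<bar>f (fold_unit z)\<bar> \<le> b" for z by (intro b fold_unit_in_unit)
  \<comment> \<open>A common bound for the shifts gives one bounded interval outside which all integrands vanish.\<close>
  obtain R where R: "\<And>n. \<bar>u n\<bar> \<le> R"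
    using convergent_imp_Bseq[of u] u by (auto simp: convergent_def Bseq_def)
  show "(\<lambda>n. smooth f (u n)) \<longlonglongrightarrow> smooth f t"
    unfolding smooth_def
  proof (rule integral_dominated_convergence[where w="\<lambda>z. indicator {-R-1..R+1} z * (C * b)"])
    show "integrable lborel (\<lambda>z. indicator {-R-1..R+1} z * (C * b))"
      by (intro integrable_mult_left integrable_real_indicator) (auto simp: emeasure_lborel_Icc_eq)
    show "AE z in lborel. norm (g (z - u n) * f (fold_unit z)) \<le> indicator {-R-1..R+1} z * (C * b)" for n
    proof (rule AE_I2)
      fix z
      have "g (z - u n) = 0" if "z \<notin> {-R-1..R+1}"
        using that R[of n] by (intro g_support) auto
      then show "norm (g (z - u n) * f (fold_unit z)) \<le> indicator {-R-1..R+1} z * (C * b)"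
        using b'[of z] g_le[of "z - u n"] g_nonneg[of "z - u n"] C_nonneg
        by (auto simp: abs_mult intro!: mult_mono split: split_indicator)
    qed
    have "countable ((\<lambda>d. d + t) ` {x. \<not> isCont g x})"
      using countable_discontinuities by (rule countable_image)
    then have "AE z in lborel. z \<notin> (\<lambda>d. d + t) ` {x. \<not> isCont g x}"
      by (intro AE_not_in countable_imp_null_set_lborel)
    then show "AE z in lborel. (\<lambda>n. g (z - u n) * f (fold_unit z)) \<longlonglongrightarrow> g (z - t) * f (fold_unit z)"
    proof eventually_elim
      case (elim z)
      then have "isCont g (z - t)" by (force simp: image_iff)
      then show ?case
        by (intro tendsto_mult tendsto_const isCont_tendsto_compose[of "z - t" g] tendsto_diff u)
    qed
  qed measurable
qed

lemma prob_space_folded_law: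
  assumes "real_distribution \<nu>"
  shows "prob_space (folded_law \<nu>)" "sets (folded_law \<nu>) = sets unit_borel"
proof -
  interpret \<nu>: real_distribution \<nu> by fact
  interpret N: prob_space noise by (rule prob_space_noise)
  interpret P: pair_prob_space noise \<nu> ..
  have "prob_space (noise \<star> \<nu>)"
    unfolding convolution_def by (rule P.prob_space_distr) measurable
  then show "prob_space (folded_law \<nu>)"
    unfolding folded_law_def
    by (rule prob_space.prob_space_distr) (use fold_unit_measurable in simp)
qed (simp add: folded_law_def)

lemma integral_folded_law:
  assumes \<nu>: "real_distribution \<nu>" and f: "f \<in> borel_measurable unit_borel"
    and b: "\<And>x. x \<in> {0..1} \<Longrightarrow> \<bar>f x\<bar> \<le> b"
  shows "(\<integral>y. f y \<partial>folded_law \<nu>) = (\<integral>t. smooth f t \<partial>\<nu>)"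
proof -
  interpret \<nu>: real_distribution \<nu> by fact
  interpret N: prob_space noise by (rule prob_space_noise)
  interpret P: pair_prob_space noise \<nu> ..
  define F where "F z = f (fold_unit z)" for z
  have F[measurable]: "F \<in> borel_measurable borel"
    unfolding F_def by (rule measurable_compose[OF fold_unit_measurable f])
  have F_le: "\<bar>F z\<bar> \<le> b" for z unfolding F_def by (intro b fold_unit_in_unit)
  have "(\<integral>y. f y \<partial>folded_law \<nu>) = (\<integral>z. F z \<partial>(noise \<star> \<nu>))"
    unfolding folded_law_def F_def
    by (rule integral_distr) (use fold_unit_measurable f in simp_all)
  also have "\<dots> = (\<integral>p. F (case p of (x, y) \<Rightarrow> x + y) \<partial>(noise \<Otimes>\<^sub>M \<nu>))"
    unfolding convolution_def by (rule integral_distr) measurable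
  also have "\<dots> = (\<integral>(x, y). F (x + y) \<partial>(noise \<Otimes>\<^sub>M \<nu>))"
    by (intro Bochner_Integration.integral_cong) auto
  also have "\<dots> = (\<integral>t. \<integral>x. F (x + t) \<partial>noise \<partial>\<nu>)"
    by (rule P.integral_snd[symmetric], rule P.integrable_const_bound[where B=b]) (auto simp: F_le)
  also have "\<dots> = (\<integral>t. smooth f t \<partial>\<nu>)"
    by (simp add: integral_noise_shift smooth_def F_def[symmetric])
  finally show ?thesis .
qed

lemma kernel_nonneg: "0 \<le> kernel t y"
  unfolding kernel_def by (intro add_nonneg_nonneg g_nonneg)

lemma kernel_le: "kernel t y \<le> 3 * C"
  unfolding kernel_def using g_le[of "y - t"] g_le[of "- y - t"] g_le[of "2 - y - t"] by linarith

text \<open>The reflected branches reverse the order, whence the minus signs.\<close>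

lemma kernel_control:
  assumes "x \<le> y"
  shows "\<bar>kernel t x - kernel t y\<bar> \<le>
    (W (y - t) - W (- y - t) - W (2 - y - t)) - (W (x - t) - W (- x - t) - W (2 - x - t))"
  using control[of "x - t" "y - t"] control[of "- y - t" "- x - t"]
    control[of "2 - y - t" "2 - x - t"] assms
  unfolding kernel_def by linarith

text \<open>For \<open>y\<close> in \<open>[0,1]\<close> the arguments \<open>y - t\<close>, \<open>- y - t\<close>, \<open>2 - y - t\<close> run through three
  adjacent intervals of the line. The total increment over the three is therefore at most the
  increment of \<open>W\<close> over their union: folding costs no factor 3.\<close>

lemma kernel_control_range:
  assumes "0 \<le> x" "x \<le> y" "y \<le> 1"
  shows "(W (y - t) - W (- y - t) - W (2 - y - t)) - (W (x - t) - W (- x - t) - W (2 - x - t)) \<le> C"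
  using monoD[OF W_mono, of "y - t" "2 - y - t"] monoD[OF W_mono, of "- x - t" "x - t"]
    W_le[of "2 - x - t"] W_nonneg[of "- y - t"] assms by simp

lemma folded_law_eq_density:
  assumes \<nu>: "real_distribution \<nu>" and supp: "AE t in \<nu>. t \<in> {0..1}"
  shows "folded_law \<nu> = density (leb_on {0..1}) (\<lambda>y. ennreal (\<integral>t. kernel t y \<partial>\<nu>))"
proof (rule measure_eqI)
  interpret \<nu>: real_distribution \<nu> by fact
  interpret N: prob_space noise by (rule prob_space_noise)
  interpret P: pair_sigma_finite lborel \<nu> ..
  have sets01: "sets (leb_on {0..1}) = sets unit_borel"
    by (rule sets_restrict_space_cong) simp
  have [measurable]: "(\<lambda>t. kernel t y) \<in> borel_measurable \<nu>" for y
    unfolding kernel_def by measurable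
  have nn: "(\<integral>\<^sup>+t. ennreal (kernel t y) \<partial>\<nu>) = ennreal (\<integral>t. kernel t y \<partial>\<nu>)" for y
  proof (rule nn_integral_eq_integral)
    show "integrable \<nu> (\<lambda>t. kernel t y)"
      using kernel_nonneg kernel_le
      by (intro \<nu>.integrable_const_bound[where B="3*C"]) (auto simp: kernel_def)
  qed (simp add: kernel_nonneg)
  show "sets (folded_law \<nu>) = sets (density (leb_on {0..1}) (\<lambda>y. ennreal (\<integral>t. kernel t y \<partial>\<nu>)))"
    by (simp add: folded_law_def sets01)
  fix A assume "A \<in> sets (folded_law \<nu>)"
  then have A: "A \<in> sets unit_borel" by (simp add: folded_law_def)
  then have A'[measurable]: "A \<in> sets borel" and A01: "A \<subseteq> {0..1}"
    by (auto simp: sets_restrict_space_iff)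
  have "emeasure (folded_law \<nu>) A = (\<integral>\<^sup>+y. indicator A y \<partial>folded_law \<nu>)"
    using A by (simp add: folded_law_def)
  also have "\<dots> = (\<integral>\<^sup>+z. indicator A (fold_unit z) \<partial>(noise \<star> \<nu>))"
    unfolding folded_law_def using A fold_unit_measurable by (subst nn_integral_distr) auto
  also have "\<dots> = (\<integral>\<^sup>+z. indicator A (fold_unit z) \<partial>(\<nu> \<star> noise))"
    by (subst convolution_commutative) (auto intro: N.finite_measure_axioms \<nu>.finite_measure_axioms)
  also have "\<dots> = (\<integral>\<^sup>+t. \<integral>\<^sup>+x. indicator A (fold_unit (t + x)) \<partial>noise \<partial>\<nu>)"
    by (rule nn_integral_convolution)
       (auto intro: N.finite_measure_axioms \<nu>.finite_measure_axioms)
  also have "\<dots> = (\<integral>\<^sup>+t. \<integral>\<^sup>+y. ennreal (kernel t y) * indicator A y \<partial>lborel \<partial>\<nu>)"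
  proof (rule nn_integral_cong_AE, use supp in eventually_elim)
    case (elim t)
    have "(\<integral>\<^sup>+x. indicator A (fold_unit (t + x)) \<partial>noise) =
        (\<integral>\<^sup>+x. ennreal (g x) * indicator A (fold_unit (t + x)) \<partial>lborel)"
      unfolding noise_def by (rule nn_integral_density) measurable
    also have "\<dots> = (\<integral>\<^sup>+z. ennreal (g (z - t)) * indicator A (fold_unit z) \<partial>lborel)"
      by (subst nn_integral_real_affine[where c=1 and t=t
          and f="\<lambda>z. ennreal (g (z - t)) * indicator A (fold_unit z)"]) auto
    also have "\<dots> = (\<integral>\<^sup>+y. (ennreal (g (y - t)) + ennreal (g (- y - t)) + ennreal (g (2 - y - t)))
        * indicator A y * indicator {0..1} y \<partial>lborel)"
      using elim by (intro nn_integral_fold_unit) (auto simp: g_support)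
    also have "\<dots> = (\<integral>\<^sup>+y. ennreal (kernel t y) * indicator A y \<partial>lborel)"
      using A01 by (intro nn_integral_cong)
        (auto simp: kernel_def g_nonneg split: split_indicator simp flip: ennreal_plus)
    finally show ?case .
  qed
  also have "\<dots> = (\<integral>\<^sup>+y. \<integral>\<^sup>+t. ennreal (kernel t y) * indicator A y \<partial>\<nu> \<partial>lborel)"
    by (rule P.Fubini') (simp add: split_beta' kernel_def)
  also have "\<dots> = (\<integral>\<^sup>+y. ennreal (\<integral>t. kernel t y \<partial>\<nu>) * indicator A y \<partial>lborel)"
    by (simp add: nn_integral_multc nn)
  also have "\<dots> = (\<integral>\<^sup>+y. ennreal (\<integral>t. kernel t y \<partial>\<nu>) * indicator A y \<partial>leb_on {0..1})"
    using A01 by (subst nn_integral_restrict_space)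
      (auto intro!: nn_integral_cong split: split_indicator)
  also have "\<dots> = emeasure (density (leb_on {0..1}) (\<lambda>y. ennreal (\<integral>t. kernel t y \<partial>\<nu>))) A"
  proof (rule emeasure_density[symmetric])
    show "(\<lambda>y. ennreal (\<integral>t. kernel t y \<partial>\<nu>)) \<in> borel_measurable (leb_on {0..1})"
      by (intro measurable_restrict_space1) (simp add: kernel_def)
    show "A \<in> sets (leb_on {0..1})" using A by (simp add: sets01)
  qed
  finally show "emeasure (folded_law \<nu>) A = \<dots>" .
qed

lemma variation_on_averaged_kernel_le:
  assumes \<nu>: "real_distribution \<nu>"
  shows "variation_on {0..1} (\<lambda>y. \<integral>t. kernel t y \<partial>\<nu>) \<le> ennreal C"
proof -
  interpret \<nu>: real_distribution \<nu> by fact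
  define H where "H t y = W (y - t) - W (- y - t) - W (2 - y - t)" for t y
  have int_k: "integrable \<nu> (\<lambda>t. kernel t y)" for y
    using kernel_nonneg kernel_le
    by (intro \<nu>.integrable_const_bound[where B="3*C"]) (auto simp: kernel_def)
  have int_W: "integrable \<nu> (\<lambda>t. W (c - t))" for c
    using W_nonneg W_le by (intro \<nu>.integrable_const_bound[where B=C]) auto
  have int_H: "integrable \<nu> (\<lambda>t. H t y)" for y
    unfolding H_def by (intro Bochner_Integration.integrable_diff int_W)
  show ?thesis
  proof (rule variation_on_le_of_control[where H="\<lambda>y. \<integral>t. H t y \<partial>\<nu>"])
    fix x y :: real assume xy: "x \<in> {0..1}" "y \<in> {0..1}" "x \<le> y"
    have "\<bar>(\<integral>t. kernel t x \<partial>\<nu>) - (\<integral>t. kernel t y \<partial>\<nu>)\<bar> = \<bar>\<integral>t. kernel t x - kernel t y \<partial>\<nu>\<bar>"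
      by (simp add: int_k)
    also have "\<dots> \<le> (\<integral>t. \<bar>kernel t x - kernel t y\<bar> \<partial>\<nu>)" by (rule integral_abs_bound)
    also have "\<dots> \<le> (\<integral>t. H t y - H t x \<partial>\<nu>)"
      using kernel_control[OF xy(3)] int_k int_H unfolding H_def
      by (intro integral_mono) (auto intro: Bochner_Integration.integrable_diff)
    also have "\<dots> = (\<integral>t. H t y \<partial>\<nu>) - (\<integral>t. H t x \<partial>\<nu>)" by (simp add: int_H)
    finally show "\<bar>(\<integral>t. kernel t x \<partial>\<nu>) - (\<integral>t. kernel t y \<partial>\<nu>)\<bar> \<le> \<dots>" .
    have "(\<integral>t. H t y \<partial>\<nu>) - (\<integral>t. H t x \<partial>\<nu>) = (\<integral>t. H t y - H t x \<partial>\<nu>)" by (simp add: int_H)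
    also have "\<dots> \<le> C"
      using kernel_control_range[of x y] xy int_H unfolding H_def
      by (intro \<nu>.integral_le_const) auto
    finally show "(\<integral>t. H t y \<partial>\<nu>) - (\<integral>t. H t x \<partial>\<nu>) \<le> C" .
  qed
qed

lemma borel_measurable_smooth:
  assumes "f \<in> borel_measurable unit_borel" "\<And>x. x \<in> {0..1} \<Longrightarrow> \<bar>f x\<bar> \<le> b"
  shows "smooth f \<in> borel_measurable borel"
  using isCont_smooth[OF assms]
  by (intro borel_measurable_continuous_onI continuous_at_imp_continuous_on) auto

text \<open>The argument of Krylov and Bogolyubov. The transfer operator \<open>L\<close> moves the Cesaro averages of an
  orbit by \<open>O(1/n)\<close>. Their images under \<open>T\<close> live on a compact interval, so a subsequence of these
  images converges weakly to some \<open>M\<close>, and \<open>\<eta>\<close> is the law of folded \<open>M\<close> plus noise.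
  Weak convergence alone would not pass through the discontinuous map \<open>T\<close>. But the noise makes
  every bounded Borel function continuous, so the averages converge to \<open>\<eta>\<close> tested against all
  bounded Borel functions, in particular against \<open>U f\<close>, the composition of a smoothed function
  with \<open>T\<close>.\<close>

lemma exists_fixed_law:
  assumes T: "T \<in> unit_borel \<rightarrow>\<^sub>M unit_borel"
  obtains \<eta> where "prob_space \<eta>" "sets \<eta> = sets unit_borel" "folded_law (distr \<eta> borel T) = \<eta>"
proof -
  define law where "law \<eta> \<longleftrightarrow> prob_space \<eta> \<and> sets \<eta> = sets unit_borel" for \<eta> :: "real measure"
  define bounded_test where
    "bounded_test b f \<longleftrightarrow> f \<in> borel_measurable unit_borel \<and> (\<forall>x\<in>{0..1}. \<bar>f x\<bar> \<le> b)"
    for b and f :: "real \<Rightarrow> real"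
  define L where "L \<eta> = folded_law (distr \<eta> borel T)" for \<eta>
  define U where "U f x = smooth f (T x)" for f x

  have space_law: "space \<eta> = {0..1}" if "law \<eta>" for \<eta>
    using that sets_eq_imp_space_eq[of \<eta> unit_borel] by (simp add: law_def)
  have T01: "T x \<in> {0..1}" if "x \<in> {0..1}" for x
    using measurable_space[OF T, of x] that by simp
  have T_law: "T \<in> \<eta> \<rightarrow>\<^sub>M borel" if "law \<eta>" for \<eta>
    using T that measurable_cong_sets[of \<eta> unit_borel borel borel]
    by (auto simp: law_def measurable_restrict_space2_iff)
  have push: "real_distribution (distr \<eta> borel T)" if "law \<eta>" for \<eta>
    using prob_space.real_distribution_distr[OF _ T_law[OF that]] that by (simp add: law_def)
  have law_L: "law (L \<eta>)" if "law \<eta>" for \<eta>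
    using prob_space_folded_law[OF push[OF that]] by (simp add: law_def L_def)
  have U_test: "bounded_test b (U f)" if "bounded_test b f" for b f
  proof -
    have "smooth f \<in> borel_measurable borel"
      using that borel_measurable_smooth[of f b] by (auto simp: bounded_test_def)
    moreover have "T \<in> unit_borel \<rightarrow>\<^sub>M borel" using T by (simp add: measurable_restrict_space2_iff)
    ultimately have "U f \<in> borel_measurable unit_borel"
      unfolding U_def by (rule measurable_compose[rotated])
    then show ?thesis
      using that abs_smooth_le[of f b] by (auto simp: bounded_test_def U_def)
  qed
  have integral_L: "(\<integral>y. f y \<partial>L \<eta>) = (\<integral>x. U f x \<partial>\<eta>)" if "law \<eta>" "bounded_test b f" for \<eta> b f
  proof -
    have f: "f \<in> borel_measurable unit_borel" "\<And>x. x \<in> {0..1} \<Longrightarrow> \<bar>f x\<bar> \<le> b"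
      using that(2) by (auto simp: bounded_test_def)
    have "(\<integral>y. f y \<partial>L \<eta>) = (\<integral>t. smooth f t \<partial>distr \<eta> borel T)"
      unfolding L_def by (rule integral_folded_law[OF push[OF that(1)] f])
    also have "\<dots> = (\<integral>x. U f x \<partial>\<eta>)"
      unfolding U_def by (rule integral_distr[OF T_law[OF that(1)] borel_measurable_smooth[OF f]])
    finally show ?thesis .
  qed

  define orbit where "orbit i = (L ^^ i) (return unit_borel 0)" for i :: nat
  define avg where "avg n = measure_pmf (pmf_of_set {..n}) \<bind> orbit" for n :: nat
  have law_orbit: "law (orbit i)" for i
  proof (induction i)
    case 0
    then show ?case by (simp add: orbit_def law_def prob_space_return)
  next
    case (Suc i)
    then show ?case using law_L[of "orbit i"] by (simp add: orbit_def)
  qed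
  have orbit_kernel: "orbit \<in> measure_pmf p \<rightarrow>\<^sub>M subprob_algebra unit_borel" for p
    using law_orbit by (auto simp: law_def space_subprob_algebra prob_space_imp_subprob_space)
  have law_avg: "law (avg n)" for n
    unfolding law_def avg_def
  proof
    show "prob_space (measure_pmf (pmf_of_set {..n}) \<bind> orbit)"
      using law_orbit
      by (intro measure_pmf.prob_space_bind[OF _ orbit_kernel]) (simp add: law_def)
    show "sets (measure_pmf (pmf_of_set {..n}) \<bind> orbit) = sets unit_borel"
      by (rule sets_bind) (use law_orbit in \<open>auto simp: law_def\<close>)
  qed
  have integral_avg: "(\<integral>x. f x \<partial>avg n) = (\<Sum>i\<le>n. \<integral>x. f x \<partial>orbit i) / real (Suc n)"
    if "bounded_test b f" for f b n
  proof -
    have "(\<integral>x. f x \<partial>avg n) = (\<integral>i. (\<integral>x. f x \<partial>orbit i) \<partial>measure_pmf (pmf_of_set {..n}))"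
      unfolding avg_def
    proof (rule integral_bind[where K=unit_borel and B=b and B'=1])
      show "AE i in measure_pmf (pmf_of_set {..n}). emeasure (orbit i) (space (orbit i)) \<le> ennreal 1"
        using law_orbit by (simp add: law_def prob_space.emeasure_space_1)
    qed (use that orbit_kernel in \<open>auto simp: bounded_test_def intro: measure_pmf.finite_measure\<close>)
    also have "\<dots> = (\<Sum>i\<le>n. \<integral>x. f x \<partial>orbit i) / real (Suc n)"
      by (simp add: integral_pmf_of_set)
    finally show ?thesis .
  qed
  have integral_L_avg: "(\<integral>x. f x \<partial>L (avg n)) - (\<integral>x. f x \<partial>avg n) =
      ((\<integral>x. f x \<partial>orbit (Suc n)) - (\<integral>x. f x \<partial>orbit 0)) / real (Suc n)"
    if f: "bounded_test b f" for f b n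
  proof -
    have "(\<integral>x. f x \<partial>L (avg n)) = (\<Sum>i\<le>n. \<integral>x. U f x \<partial>orbit i) / real (Suc n)"
      by (simp add: integral_L[OF law_avg f] integral_avg[OF U_test[OF f]])
    also have "(\<Sum>i\<le>n. \<integral>x. U f x \<partial>orbit i) = (\<Sum>i\<le>n. \<integral>x. f x \<partial>orbit (Suc i))"
      using integral_L[OF law_orbit f] by (simp add: orbit_def)
    finally have "(\<integral>x. f x \<partial>L (avg n)) - (\<integral>x. f x \<partial>avg n) =
        (\<Sum>i\<le>n. (\<integral>x. f x \<partial>orbit (Suc i)) - (\<integral>x. f x \<partial>orbit i)) / real (Suc n)"
      by (simp add: integral_avg[OF f] sum_subtractf diff_divide_distrib)
    then show ?thesis
      using sum_lessThan_telescope[of "\<lambda>i. \<integral>x. f x \<partial>orbit i" "Suc n"]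
      by (simp add: lessThan_Suc_atMost)
  qed
  have abs_integral_le: "\<bar>\<integral>x. f x \<partial>\<eta>\<bar> \<le> b" if "law \<eta>" "bounded_test b f" for \<eta> b f
  proof -
    interpret prob_space \<eta> using that by (simp add: law_def)
    have b: "AE x in \<eta>. \<bar>f x\<bar> \<le> b"
      using that space_law[OF that(1)] by (intro AE_I2) (auto simp: bounded_test_def)
    have "f \<in> borel_measurable \<eta>"
      using that measurable_cong_sets[of \<eta> unit_borel borel borel]
      by (auto simp: law_def bounded_test_def)
    then have int: "integrable \<eta> f" using b by (intro integrable_const_bound[where B=b]) auto
    have "\<bar>\<integral>x. f x \<partial>\<eta>\<bar> \<le> (\<integral>x. \<bar>f x\<bar> \<partial>\<eta>)" by (rule integral_abs_bound)
    also have "\<dots> \<le> b" using int b by (intro integral_le_const integrable_abs)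
    finally show ?thesis .
  qed
  have asymptotically_invariant: "(\<lambda>n. (\<integral>x. f x \<partial>L (avg n)) - (\<integral>x. f x \<partial>avg n)) \<longlonglongrightarrow> 0"
    if f: "bounded_test b f" for f b
  proof (rule Lim_null_comparison[where g="\<lambda>n. 2 * b * inverse (real (Suc n))"])
    show "\<forall>\<^sub>F n in sequentially. norm ((\<integral>x. f x \<partial>L (avg n)) - (\<integral>x. f x \<partial>avg n)) \<le> 2 * b * inverse (real (Suc n))"
    proof (intro always_eventually allI)
      fix n
      have "\<bar>(\<integral>x. f x \<partial>orbit (Suc n)) - (\<integral>x. f x \<partial>orbit 0)\<bar> \<le> 2 * b"
        using abs_integral_le[OF law_orbit f, of "Suc n"] abs_integral_le[OF law_orbit f, of 0] by linarith
      then show "norm ((\<integral>x. f x \<partial>L (avg n)) - (\<integral>x. f x \<partial>avg n)) \<le> 2 * b * inverse (real (Suc n))"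
        unfolding integral_L_avg[OF f] by (simp add: divide_simps)
    qed
    show "(\<lambda>n. 2 * b * inverse (real (Suc n))) \<longlonglongrightarrow> 0"
      by (intro tendsto_mult_right_zero LIMSEQ_inverse_real_of_nat)
  qed

  \<comment> \<open>Only the images under \<open>T\<close> are passed to the weak limit; the averages are recovered from them
    through \<open>L\<close> and the noise.\<close>
  define \<nu> where "\<nu> n = distr (avg n) borel T" for n
  have \<nu>: "real_distribution (\<nu> n)" for n unfolding \<nu>_def by (rule push[OF law_avg])
  have "measure (\<nu> n) {-1<..1} = 1" for n
  proof -
    interpret prob_space "avg n" using law_avg by (simp add: law_def)
    have "T -` {-1<..1} \<inter> space (avg n) = space (avg n)"
      using T01 space_law[OF law_avg] by force
    then show ?thesis unfolding \<nu>_def using T_law[OF law_avg] by (simp add: measure_distr prob_space)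
  qed
  then have "tight \<nu>"
    unfolding tight_def using \<nu> by (intro conjI allI impI exI[of _ "-1"] exI[of _ 1]) auto
  from tight_imp_convergent_subsubsequence[OF this strict_mono_id]
  obtain r M where r: "strict_mono r" and M: "real_distribution M" and conv: "weak_conv_m (\<nu> \<circ> id \<circ> r) M"
    by blast
  define \<eta> where "\<eta> = folded_law M"
  have law_\<eta>: "law \<eta>" using prob_space_folded_law[OF M] by (simp add: law_def \<eta>_def)
  have lim_L_avg: "(\<lambda>n. \<integral>x. f x \<partial>L (avg (r n))) \<longlonglongrightarrow> (\<integral>x. f x \<partial>\<eta>)" if "bounded_test b f" for f b
  proof -
    have f: "f \<in> borel_measurable unit_borel" "\<And>x. x \<in> {0..1} \<Longrightarrow> \<bar>f x\<bar> \<le> b"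
      using that by (auto simp: bounded_test_def)
    have "(\<lambda>n. \<integral>t. smooth f t \<partial>(\<nu> \<circ> id \<circ> r) n) \<longlonglongrightarrow> (\<integral>t. smooth f t \<partial>M)"
      by (rule weak_conv_imp_integral_bdd_continuous_conv[OF _ M conv isCont_smooth[OF f], where B=b])
         (use \<nu> abs_smooth_le[OF f] in auto)
    moreover have "(\<integral>x. f x \<partial>L (avg (r n))) = (\<integral>t. smooth f t \<partial>(\<nu> \<circ> id \<circ> r) n)" for n
      unfolding L_def \<nu>_def o_def id_def by (rule integral_folded_law[OF push[OF law_avg] f])
    moreover have "(\<integral>x. f x \<partial>\<eta>) = (\<integral>t. smooth f t \<partial>M)"
      unfolding \<eta>_def by (rule integral_folded_law[OF M f])
    ultimately show ?thesis by simp
  qed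
  have lim_avg: "(\<lambda>n. \<integral>x. f x \<partial>avg (r n)) \<longlonglongrightarrow> (\<integral>x. f x \<partial>\<eta>)" if f: "bounded_test b f" for f b
  proof -
    have "(\<lambda>n. (\<integral>x. f x \<partial>L (avg (r n))) - (\<integral>x. f x \<partial>avg (r n))) \<longlonglongrightarrow> 0"
      using LIMSEQ_subseq_LIMSEQ[OF asymptotically_invariant[OF f] r] by (simp add: o_def)
    from tendsto_diff[OF lim_L_avg[OF f] this] show ?thesis by simp
  qed
  have invariant: "(\<integral>x. f x \<partial>L \<eta>) = (\<integral>x. f x \<partial>\<eta>)" if f: "bounded_test b f" for f b
  proof -
    have "(\<lambda>n. \<integral>x. U f x \<partial>avg (r n)) \<longlonglongrightarrow> (\<integral>x. U f x \<partial>\<eta>)"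
      by (rule lim_avg[OF U_test[OF f]])
    then have "(\<lambda>n. \<integral>x. f x \<partial>L (avg (r n))) \<longlonglongrightarrow> (\<integral>x. f x \<partial>L \<eta>)"
      by (simp add: integral_L[OF law_avg f] integral_L[OF law_\<eta> f])
    with lim_L_avg[OF f] show ?thesis using LIMSEQ_unique by blast
  qed
  have "L \<eta> = \<eta>"
  proof (rule measure_eqI)
    show "sets (L \<eta>) = sets \<eta>" using law_\<eta> law_L[OF law_\<eta>] by (simp add: law_def)
    fix A assume "A \<in> sets (L \<eta>)"
    then have A: "A \<in> sets unit_borel" using law_L[OF law_\<eta>] by (simp add: law_def)
    interpret \<eta>: prob_space \<eta> using law_\<eta> by (simp add: law_def)
    interpret L: prob_space "L \<eta>" using law_L[OF law_\<eta>] by (simp add: law_def)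
    have "bounded_test 1 (indicator A)" using A by (simp add: bounded_test_def indicator_def)
    from invariant[OF this] show "emeasure (L \<eta>) A = emeasure \<eta> A"
      using A law_\<eta> law_L[OF law_\<eta>] by (simp add: law_def \<eta>.emeasure_eq_measure L.emeasure_eq_measure)
  qed
  with law_\<eta> that show thesis by (auto simp: law_def L_def)
qed

end

section \<open>From a density of bounded variation to a control\<close>

lemma nonneg_representative:
  assumes dens: "prob_density_on S \<rho>" and "\<epsilon> > 0" and e: "0 \<le> e" and ess: "ess_variation_on S \<rho> = ennreal e"
  obtains \<psi> where "AE x in leb_on S. \<psi> x = \<rho> x" "\<And>x. 0 \<le> \<psi> x"
    "variation_on S \<psi> \<le> ennreal (e + \<epsilon>)"
proof -
  have "ess_variation_on S \<rho> < ennreal (e + \<epsilon>)"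
    using \<open>\<epsilon> > 0\<close> e unfolding ess by (intro ennreal_lessI) auto
  then obtain \<psi> where \<psi>: "AE x in leb_on S. \<psi> x = \<rho> x" "variation_on S \<psi> < ennreal (e + \<epsilon>)"
    unfolding ess_variation_on_def INF_less_iff by blast
  have "AE x in leb_on S. 0 \<le> \<rho> x" using dens by (simp add: prob_density_on_def)
  with \<psi>(1) have "AE x in leb_on S. \<bar>\<psi> x\<bar> = \<rho> x" by eventually_elim simp
  moreover have "variation_on S (\<lambda>x. \<bar>\<psi> x\<bar>) \<le> ennreal (e + \<epsilon>)"
    using variation_on_abs_le[of S \<psi>] \<psi>(2) by simp
  ultimately show thesis by (intro that[of "\<lambda>x. \<bar>\<psi> x\<bar>"]) auto
qed

text \<open>Extension by zero adds the jumps \<open>\<psi> (-1)\<close> and \<open>\<psi> 1\<close>. Comparing both with the value at an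
  arbitrary point \<open>x\<close> gives \<open>\<psi> (-1) + \<psi> 1 \<le> v + 2 * \<psi> x\<close>, and averaging over \<open>x\<close> in
  \<open>[-1,1]\<close>, where \<open>\<psi>\<close> has mean \<open>1/2\<close>, bounds the jumps by \<open>v + 1\<close>.\<close>

lemma controlled_zero_extension:
  fixes \<psi> :: "real \<Rightarrow> real"
  assumes var: "variation_on {-1..1} \<psi> = ennreal v" "0 \<le> v" and nonneg: "\<And>x. 0 \<le> \<psi> x"
    and mass: "(\<integral>\<^sup>+x. ennreal (\<psi> x) \<partial>leb_on {-1..1}) = 1"
  obtains W C where "controlled_density (\<lambda>x. \<psi> x * indicator {-1..1} x) W C" "C \<le> 2 * v + 1"
proof -
  obtain V where V: "\<And>x y. x \<in> {-1..1} \<Longrightarrow> y \<in> {-1..1} \<Longrightarrow> x \<le> y \<Longrightarrow> \<bar>\<psi> x - \<psi> y\<bar> \<le> V y - V x"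
    and V_range: "\<And>x. 0 \<le> V x" "\<And>x. V x \<le> v"
    using bounded_variation_control[OF var] by blast
  define g where "g x = \<psi> x * indicator {-1..1} x" for x
  define W where "W x = (if x < -1 then 0 else if x \<le> 1 then \<psi> (-1) + V x else \<psi> (-1) + v + \<psi> 1)" for x
  define C where "C = \<psi> (-1) + v + \<psi> 1"
  have mass_g: "(\<integral>\<^sup>+x. ennreal (g x) \<partial>lborel) = 1"
  proof -
    have "(\<integral>\<^sup>+x. ennreal (g x) \<partial>lborel) = (\<integral>\<^sup>+x. ennreal (\<psi> x) * indicator {-1..1} x \<partial>lborel)"
      unfolding g_def by (intro nn_integral_cong) (auto split: split_indicator)
    then show ?thesis using mass by (simp add: nn_integral_restrict_space)
  qed
  interpret controlled_density g W C
  proof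
    show "\<bar>g x - g y\<bar> \<le> W y - W x" if "x \<le> y" for x y
    proof -
      consider "y < -1" | "1 < x" | "x < -1" "1 < y" | "x < -1" "y \<in> {-1..1}"
        | "x \<in> {-1..1}" "1 < y" | "x \<in> {-1..1}" "y \<in> {-1..1}"
        using \<open>x \<le> y\<close> by fastforce
      then show ?thesis
      proof cases
        case 3
        then show ?thesis using nonneg[of "-1"] nonneg[of 1] var(2) by (simp add: g_def W_def)
      next
        case 4
        then show ?thesis
          using V[of "-1" y] V_range(1)[of "-1"] nonneg[of y] by (simp add: g_def W_def)
      next
        case 5
        then show ?thesis
          using V[of x 1] V_range(2)[of 1] nonneg[of x] by (simp add: g_def W_def)
      next
        case 6
        then show ?thesis using V[of x y] \<open>x \<le> y\<close> by (simp add: g_def W_def)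
      qed (use \<open>x \<le> y\<close> in \<open>auto simp: g_def W_def\<close>)
    qed
    show "0 \<le> W x" "W x \<le> C" for x
      using nonneg[of "-1"] nonneg[of 1] var(2) V_range[of x] by (auto simp: W_def C_def)
    show "0 \<le> g x" for x using nonneg by (simp add: g_def)
    show "g x = 0" if "x \<notin> {-1..1}" for x using that by (simp add: g_def)
  qed (rule mass_g)
  define c where "c = \<psi> (-1) + \<psi> 1"
  have c0: "0 \<le> c" using nonneg by (simp add: c_def)
  have ends: "c \<le> v + 2 * g x" if "x \<in> {-1..1}" for x
    using V[of "-1" x] V[of x 1] that V_range(1)[of "-1"] V_range(2)[of 1] by (simp add: g_def c_def)
  have "ennreal (2 * c) = (\<integral>\<^sup>+x. ennreal c * indicator {-1..1::real} x \<partial>lborel)"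
    using c0 by (simp add: nn_integral_cmult_indicator ennreal_mult' mult.commute)
  also have "\<dots> \<le> (\<integral>\<^sup>+x. ennreal v * indicator {-1..1::real} x + 2 * ennreal (g x) \<partial>lborel)"
  proof (intro nn_integral_mono)
    fix x :: real
    show "ennreal c * indicator {-1..1} x \<le> ennreal v * indicator {-1..1} x + 2 * ennreal (g x)"
    proof (cases "x \<in> {-1..1}")
      case True
      have "ennreal c \<le> ennreal (v + 2 * g x)" by (rule ennreal_leI[OF ends[OF True]])
      also have "\<dots> = ennreal v + 2 * ennreal (g x)"
        using var(2) g_nonneg[of x] by (simp add: ennreal_plus ennreal_mult')
      finally show ?thesis using True by simp
    qed simp
  qed
  also have "\<dots> = ennreal v * 2 + 2"
    by (simp add: nn_integral_add nn_integral_cmult mass_g nn_integral_cmult_indicator)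
  also have "\<dots> = ennreal (2 * v + 2)"
    using var(2) by (simp add: ennreal_plus ennreal_mult' mult.commute)
  finally have "2 * c \<le> 2 * v + 2"
    using var(2) by (subst (asm) ennreal_le_iff) auto
  then have "C \<le> 2 * v + 1" by (simp add: C_def c_def)
  then show thesis
    using that[of W C] controlled_density_axioms unfolding g_def[abs_def] by blast
qed

section \<open>The stationary density\<close>

theorem theorem77:
  fixes T \<rho> :: "real \<Rightarrow> real"
  assumes "T \<in> restrict_space borel {0..1} \<rightarrow>\<^sub>M restrict_space borel {0..1}"
    and "nonsingular (leb_on {0..1}) T"
    and "prob_density_on {-1..1} \<rho>"
    and "AE x in leb_on {-1..1}. \<rho> x = \<rho> (- x)"
    and "\<rho> \<in> BV_on {-1..1}"
  shows "\<exists>\<eta> h. stationary T \<rho> \<eta> \<and> prob_density_on {0..1} h \<and>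
    \<eta> = density (leb_on {0..1}) (\<lambda>x. ennreal (h x)) \<and>
    h \<in> BV_on {0..1} \<and> BV_norm_on {0..1} h \<le> 3 * BV_norm_on {-1..1} \<rho>"
proof -
  note T = assms(1) and dens = assms(3) and BV = assms(5)
  obtain e where e: "0 \<le> e" "ess_variation_on {-1..1} \<rho> = ennreal e"
    using BV by (cases "ess_variation_on {-1..1} \<rho>") (auto simp: BV_on_def)
  \<comment> \<open>The excess \<open>1/2\<close> over the essential variation is affordable: it leads to the bound
    \<open>2 * e + 3\<close>, still at most \<open>3 * (e + 1)\<close>.\<close>
  obtain \<psi> where \<psi>: "AE x in leb_on {-1..1}. \<psi> x = \<rho> x" "\<And>x. 0 \<le> \<psi> x"
    and var_le: "variation_on {-1..1} \<psi> \<le> ennreal (e + 1/2)"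
    using nonneg_representative[OF dens _ e, of "1/2"] by auto
  obtain v where v: "0 \<le> v" "variation_on {-1..1} \<psi> = ennreal v"
    using var_le by (cases "variation_on {-1..1} \<psi>") (auto simp: top_unique)
  have v_le: "v \<le> e + 1/2" using var_le[unfolded v(2)] e(1) by (subst (asm) ennreal_le_iff) auto
  have "(\<integral>\<^sup>+x. ennreal (\<psi> x) \<partial>leb_on {-1..1}) = (\<integral>\<^sup>+x. ennreal (\<rho> x) \<partial>leb_on {-1..1})"
    by (rule nn_integral_cong_AE) (use \<psi>(1) in eventually_elim, simp)
  then have mass: "(\<integral>\<^sup>+x. ennreal (\<psi> x) \<partial>leb_on {-1..1}) = 1"
    using dens by (simp add: prob_density_on_def)
  obtain W C where W: "controlled_density (\<lambda>x. \<psi> x * indicator {-1..1} x) W C" and C: "C \<le> 2 * v + 1"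
    using controlled_zero_extension[OF v(2,1) \<psi>(2) mass] by blast
  interpret controlled_density "\<lambda>x. \<psi> x * indicator {-1..1} x" W C by (rule W)

  have noise: "noise_measure \<rho> = noise"
    unfolding noise_measure_def noise_def
  proof (rule density_cong)
    have "(\<lambda>x. ennreal (\<rho> x)) \<in> borel_measurable (restrict_space lborel {-1..1})"
      using dens unfolding prob_density_on_def by (intro measurable_compose[OF _ measurable_ennreal]) blast
    then show "(\<lambda>x. ennreal (\<rho> x) * indicator {-1..1} x) \<in> borel_measurable lborel"
      by (subst (asm) borel_measurable_restrict_space_iff_ennreal) (auto simp: mult.commute)
    show "(\<lambda>x. ennreal (\<psi> x * indicator {-1..1} x)) \<in> borel_measurable lborel"
      using borel_measurable_g by simp
    have "AE x in lborel. x \<in> {-1..1} \<longrightarrow> \<psi> x = \<rho> x"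
      using \<psi>(1) by (subst (asm) AE_restrict_space_iff) auto
    then show "AE x in lborel. ennreal (\<rho> x) * indicator {-1..1} x = ennreal (\<psi> x * indicator {-1..1} x)"
      by eventually_elim (auto split: split_indicator)
  qed

  obtain \<eta> where \<eta>: "prob_space \<eta>" "sets \<eta> = sets unit_borel" "folded_law (distr \<eta> borel T) = \<eta>"
    using exists_fixed_law[OF T] by blast
  interpret \<eta>: prob_space \<eta> by (rule \<eta>(1))
  have space_\<eta>: "space \<eta> = {0..1}" using sets_eq_imp_space_eq[OF \<eta>(2)] by simp
  have T_\<eta>: "T \<in> \<eta> \<rightarrow>\<^sub>M borel"
    using T unfolding measurable_cong_sets[OF \<eta>(2) refl] by (simp add: measurable_restrict_space2_iff)
  have \<nu>: "real_distribution (distr \<eta> borel T)" by (rule \<eta>.real_distribution_distr[OF T_\<eta>])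
  have supp: "AE t in distr \<eta> borel T. t \<in> {0..1}"
    using measurable_space[OF T] space_\<eta> by (subst AE_distr_iff[OF T_\<eta>]) (auto intro!: AE_I2)
  define h where "h y = (\<integral>t. kernel t y \<partial>distr \<eta> borel T)" for y
  have \<eta>_density: "\<eta> = density (leb_on {0..1}) (\<lambda>x. ennreal (h x))"
    using folded_law_eq_density[OF \<nu> supp] unfolding h_def \<eta>(3) .
  have h_nonneg: "0 \<le> h y" for y unfolding h_def by (simp add: kernel_nonneg)
  have h_meas: "h \<in> borel_measurable (leb_on {0..1})"
  proof (rule measurable_restrict_space1)
    interpret \<nu>: real_distribution "distr \<eta> borel T" by (rule \<nu>)
    show "h \<in> borel_measurable lborel"
      unfolding h_def kernel_def by measurable
  qed
  have h_mass: "(\<integral>\<^sup>+x. ennreal (h x) \<partial>leb_on {0..1}) = 1"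
  proof -
    have "1 = emeasure \<eta> (space \<eta>)" by (simp add: \<eta>.emeasure_space_1)
    also have "\<dots> = (\<integral>\<^sup>+x. ennreal (h x) * indicator (space \<eta>) x \<partial>leb_on {0..1})"
      by (subst \<eta>_density, subst emeasure_density) (use h_meas space_\<eta> in \<open>auto simp: sets_restrict_space_iff\<close>)
    also have "\<dots> = (\<integral>\<^sup>+x. ennreal (h x) \<partial>leb_on {0..1})"
      by (intro nn_integral_cong) (simp add: space_\<eta>)
    finally show ?thesis by simp
  qed
  have ess_h: "ess_variation_on {0..1} h \<le> ennreal (2 * e + 2)"
  proof -
    have "ess_variation_on {0..1} h \<le> variation_on {0..1} h"
      unfolding ess_variation_on_def by (rule INF_lower) simp
    also have "\<dots> \<le> ennreal C" unfolding h_def by (rule variation_on_averaged_kernel_le[OF \<nu>])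
    also have "\<dots> \<le> ennreal (2 * e + 2)" using C v_le by (intro ennreal_leI) simp
    finally show ?thesis .
  qed
  have "BV_norm_on {0..1} h \<le> ennreal (2 * e + 2) + 1"
    using ess_h h_mass by (simp add: BV_norm_on_def h_nonneg add_right_mono)
  also have "\<dots> = ennreal (2 * e + 3)"
    using e(1) by (simp flip: ennreal_plus ennreal_1)
  also have "\<dots> \<le> ennreal (3 * (e + 1))" using e(1) by (intro ennreal_leI) simp
  also have "\<dots> = 3 * (ennreal e + 1)"
    using e(1) by (simp add: ennreal_mult' ennreal_plus)
  also have "\<dots> = 3 * BV_norm_on {-1..1} \<rho>"
  proof -
    have "AE x in leb_on {-1..1}. 0 \<le> \<rho> x" using dens by (simp add: prob_density_on_def)
    then have "(\<integral>\<^sup>+x. ennreal \<bar>\<rho> x\<bar> \<partial>leb_on {-1..1}) = (\<integral>\<^sup>+x. ennreal (\<rho> x) \<partial>leb_on {-1..1})"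
      by (intro nn_integral_cong_AE) (auto elim!: eventually_mono)
    then show ?thesis using dens e(2) by (simp add: BV_norm_on_def prob_density_on_def)
  qed
  finally have norm_h: "BV_norm_on {0..1} h \<le> 3 * BV_norm_on {-1..1} \<rho>" .
  have "stationary T \<rho> \<eta>"
    using \<eta> by (simp add: stationary_def transfer_op_def noise folded_law_def)
  moreover have "prob_density_on {0..1} h"
    using h_meas h_nonneg h_mass by (simp add: prob_density_on_def)
  moreover have "h \<in> BV_on {0..1}"
    using le_less_trans[OF ess_h ennreal_less_top] by (simp add: BV_on_def)
  ultimately show ?thesis using \<eta>_density norm_h by blast
qed

end
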